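(* Let $B_0$ and $B_1$ be reflexive Banach spaces and $B$ a Banach space such that $B_0$ is compactly embedded in $B$ and $B$ is continuously embedded in $B_1$. Let $1<p_0,p_1<\infty$, and let $\alpha=(\alpha_n)_{n\ge1}$ satisfy $\alpha_n>0$ for all $n$ and $\sum_{n=1}^\infty\alpha_n<\infty$. Let $\mathcal X_\alpha(B_0,B_1)$ be the space of sequences $x=(x_n)_{n\ge1}$ in $B_0$ such that $$\sum_{n=1}^\infty\alpha_n\|x_n\|_{B_0}^{p_0}<\infty\quad\text{and}\quad\sum_{n=1}^\infty\alpha_n^{1-p_1}\|x_{n+1}-x_n\|_{B_1}^{p_1}<\infty,$$ endowed with the norm $$\|x\|_{\mathcal X_\alpha}=\left(\sum_{n=1}^\infty\alpha_n\|x_n\|_{B_0}^{p_0}\right)^{1/p_0}+\left(\sum_{n=1}^\infty\alpha_n^{1-p_1}\|x_{n+1}-x_n\|_{B_1}^{p_1}\right)^{1/p_1}.$$ Then $\mathcal X_\alpha(B_0,B_1)$ is a Banach space and the inclusion $\mathcal X_\alpha(B_0,B_1)\to\ell^{p_0}(\alpha;B)$ is compact, where $\ell^{p_0}(\alpha;B)$ is the space of sequences in $B$ with finite norm given by $\|x\|_{\ell^{p_0}(\alpha;B)}^{p_0}=\sum_{n=1}^\infty\alpha_n\|x_n\|_B^{p_0}$.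
   Context: The embeddings $B_0\to B$ (compact) and $B\to B_1$ (continuous) are fixed injective bounded linear maps; elements of $B_0$ are identified with their images in $B$ and in $B_1$ (the embedding $B_0\to B_1$ being the composition). *)

theory Defs
  imports "HOL-Analysis.Analysis" "HOL-Library.Function_Algebras"
begin

section \<open>Reflexive spaces and compact maps between normed spaces\<close>

text \<open>The bidual of \<^typ>\<open>'a\<close> is \<^typ>\<open>('a \<Rightarrow>\<^sub>L real) \<Rightarrow>\<^sub>L real\<close>.\<close>

definition bidual_embedding :: "'a::real_normed_vector \<Rightarrow> ('a \<Rightarrow>\<^sub>L real) \<Rightarrow>\<^sub>L real" where
  "bidual_embedding x = Blinfun (\<lambda>\<phi>. blinfun_apply \<phi> x)"

lemma bidual_embedding_apply [simp]: "blinfun_apply (bidual_embedding x) \<phi> = blinfun_apply \<phi> x"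
  unfolding bidual_embedding_def
  by (simp add: bounded_linear_Blinfun_apply)

definition reflexive :: "'a::real_normed_vector itself \<Rightarrow> bool" where
  "reflexive _ \<longleftrightarrow> surj (bidual_embedding :: 'a \<Rightarrow> ('a \<Rightarrow>\<^sub>L real) \<Rightarrow>\<^sub>L real)"

definition compact_embedding :: "('a::real_normed_vector \<Rightarrow> 'b::real_normed_vector) \<Rightarrow> bool" where
  "compact_embedding i \<longleftrightarrow>
     bounded_linear i \<and> inj i \<and> (\<forall>A. bounded A \<longrightarrow> compact (closure (i ` A)))"

definition continuous_embedding :: "('a::real_normed_vector \<Rightarrow> 'b::real_normed_vector) \<Rightarrow> bool" where
  "continuous_embedding j \<longleftrightarrow> bounded_linear j \<and> inj j"


section \<open>Norms on linear subspaces\<close>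

text \<open>
  Sequence spaces that depend on parameters are linear subspaces \<open>S\<close> of an ambient real vector
  space with a norm \<open>N\<close> that is meaningful only on \<open>S\<close>.
\<close>

definition normed_space_on :: "'v::real_vector set \<Rightarrow> ('v \<Rightarrow> real) \<Rightarrow> bool" where
  "normed_space_on S N \<longleftrightarrow>
     subspace S \<and>
     (\<forall>x\<in>S. 0 \<le> N x) \<and>
     (\<forall>x\<in>S. N x = 0 \<longleftrightarrow> x = 0) \<and>
     (\<forall>c. \<forall>x\<in>S. N (c *\<^sub>R x) = \<bar>c\<bar> * N x) \<and>
     (\<forall>x\<in>S. \<forall>y\<in>S. N (x + y) \<le> N x + N y)"

text \<open>
  The value outside \<open>S\<close> is immaterial; it is \<open>0\<close> because \<^locale>\<open>Metric_space\<close> demands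
  nonnegativity and symmetry for all arguments.
\<close>

definition norm_metric :: "'v::real_vector set \<Rightarrow> ('v \<Rightarrow> real) \<Rightarrow> 'v \<Rightarrow> 'v \<Rightarrow> real" where
  "norm_metric S N x y = (if x \<in> S \<and> y \<in> S then N (x - y) else 0)"

lemma Metric_space_norm_metric:
  assumes "normed_space_on S N"
  shows "Metric_space S (norm_metric S N)"
proof
  have S: "subspace S"
    and nonneg: "\<And>x. x \<in> S \<Longrightarrow> 0 \<le> N x"
    and zero: "\<And>x. x \<in> S \<Longrightarrow> N x = 0 \<longleftrightarrow> x = 0"
    and scale: "\<And>c x. x \<in> S \<Longrightarrow> N (c *\<^sub>R x) = \<bar>c\<bar> * N x"
    and add: "\<And>x y. x \<in> S \<Longrightarrow> y \<in> S \<Longrightarrow> N (x + y) \<le> N x + N y"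
    using assms unfolding normed_space_on_def by simp_all
  note diff = subspace_diff[OF S]
  show "0 \<le> norm_metric S N x y" for x y
    using nonneg[OF diff, of x y] by (simp add: norm_metric_def)
  have "N (x - y) = N (y - x)" if "x \<in> S" "y \<in> S" for x y
    using scale[OF diff[OF that], of "- 1"] by simp
  then show "norm_metric S N x y = norm_metric S N y x" for x y
    unfolding norm_metric_def by metis
  show "norm_metric S N x y = 0 \<longleftrightarrow> x = y" if "x \<in> S" "y \<in> S" for x y
    using zero[OF diff[OF that]] that by (simp add: norm_metric_def)
  show "norm_metric S N x z \<le> norm_metric S N x y + norm_metric S N y z"
    if "x \<in> S" "y \<in> S" "z \<in> S" for x y z
    using add[OF diff[OF that(1,2)] diff[OF that(2,3)]] that by (simp add: norm_metric_def)
qed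

definition banach_space_on :: "'v::real_vector set \<Rightarrow> ('v \<Rightarrow> real) \<Rightarrow> bool" where
  "banach_space_on S N \<longleftrightarrow>
     normed_space_on S N \<and> Metric_space.mcomplete S (norm_metric S N)"

definition compact_linear_map_on ::
  "'v::real_vector set \<Rightarrow> ('v \<Rightarrow> real) \<Rightarrow> 'w::real_vector set \<Rightarrow> ('w \<Rightarrow> real) \<Rightarrow> ('v \<Rightarrow> 'w) \<Rightarrow> bool"
where
  "compact_linear_map_on S N T K f \<longleftrightarrow>
     normed_space_on S N \<and> normed_space_on T K \<and> linear f \<and> f ` S \<subseteq> T \<and>
     (\<forall>A. A \<subseteq> S \<and> (\<exists>c. \<forall>x\<in>A. N x \<le> c) \<longrightarrow>
        compactin (Metric_space.mtopology T (norm_metric T K))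
          (Metric_space.mtopology T (norm_metric T K) closure_of (f ` A)))"


section \<open>Sequence spaces\<close>

instantiation "fun" :: (type, real_vector) real_vector
begin

definition scaleR_fun :: "real \<Rightarrow> ('a \<Rightarrow> 'b) \<Rightarrow> 'a \<Rightarrow> 'b" where
  "scaleR_fun c f = (\<lambda>x. c *\<^sub>R f x)"

instance
proof
  fix a b :: real and f g :: "'a \<Rightarrow> 'b"
  show "a *\<^sub>R (f + g) = a *\<^sub>R f + a *\<^sub>R g"
    by (rule ext) (simp add: scaleR_fun_def scaleR_add_right)
  show "(a + b) *\<^sub>R f = a *\<^sub>R f + b *\<^sub>R f"
    by (rule ext) (simp add: scaleR_fun_def scaleR_add_left)
  show "a *\<^sub>R b *\<^sub>R f = (a * b) *\<^sub>R f"
    by (rule ext) (simp add: scaleR_fun_def)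
  show "1 *\<^sub>R f = f"
    by (rule ext) (simp add: scaleR_fun_def)
qed

end

text \<open>
  Sequences are indexed from \<open>0\<close>: \<open>\<alpha> n\<close> and \<open>x n\<close> stand for the terms of index \<open>n + 1\<close>
  in the sequences \<open>(\<alpha>\<^sub>n)\<close>, \<open>(x\<^sub>n)\<close> with \<open>n \<ge> 1\<close>.
\<close>

definition weighted_lp_space :: "(nat \<Rightarrow> real) \<Rightarrow> real \<Rightarrow> (nat \<Rightarrow> 'b::real_normed_vector) set" where
  "weighted_lp_space \<alpha> p = {x. summable (\<lambda>n. \<alpha> n * norm (x n) powr p)}"

definition weighted_lp_norm :: "(nat \<Rightarrow> real) \<Rightarrow> real \<Rightarrow> (nat \<Rightarrow> 'b::real_normed_vector) \<Rightarrow> real" where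
  "weighted_lp_norm \<alpha> p x = (\<Sum>n. \<alpha> n * norm (x n) powr p) powr (1 / p)"

text \<open>Here \<open>e\<close> is the embedding of \<open>B\<^sub>0\<close> into \<open>B\<^sub>1\<close>.\<close>

definition X_space ::
  "('b0::real_normed_vector \<Rightarrow> 'b1::real_normed_vector) \<Rightarrow> (nat \<Rightarrow> real) \<Rightarrow> real \<Rightarrow> real
    \<Rightarrow> (nat \<Rightarrow> 'b0) set" where
  "X_space e \<alpha> p0 p1 =
     {x. summable (\<lambda>n. \<alpha> n * norm (x n) powr p0) \<and>
         summable (\<lambda>n. \<alpha> n powr (1 - p1) * norm (e (x (Suc n) - x n)) powr p1)}"

definition X_norm ::
  "('b0::real_normed_vector \<Rightarrow> 'b1::real_normed_vector) \<Rightarrow> (nat \<Rightarrow> real) \<Rightarrow> real \<Rightarrow> real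
    \<Rightarrow> (nat \<Rightarrow> 'b0) \<Rightarrow> real" where
  "X_norm e \<alpha> p0 p1 x =
     (\<Sum>n. \<alpha> n * norm (x n) powr p0) powr (1 / p0) +
     (\<Sum>n. \<alpha> n powr (1 - p1) * norm (e (x (Suc n) - x n)) powr p1) powr (1 / p1)"

end

theory Submission
  imports Defs "HOL-Library.Diagonal_Subsequence"
begin

text \<open>
  Write \<open>e = j \<circ> i\<close> for the embedding of \<open>B\<^sub>0\<close> into \<open>B\<^sub>1\<close>. The norm of \<open>\<X>\<^sub>\<alpha>\<close> is the graph norm of the
  increment operator \<open>D x = (e (x\<^sub>n\<^sub>+\<^sub>1 - x\<^sub>n))\<^sub>n\<close>, regarded as an operator from a weighted \<open>\<ell>\<^sup>p\<close> space
  over \<open>B\<^sub>0\<close> to one over \<open>B\<^sub>1\<close>. Both are complete, convergence in either implies coordinatewise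
  convergence, and therefore \<open>D\<close> is closed; a closed operator between complete spaces has a complete
  graph norm. This is \<open>banach_space_on_X_space\<close>.

  For compactness, let \<open>x\<^sup>k\<close> be bounded in \<open>\<X>\<^sub>\<alpha>\<close>. Each coordinate is bounded in \<open>B\<^sub>0\<close>, hence a
  diagonal subsequence converges in \<open>B\<close>, and then in \<open>B\<^sub>1\<close>, at every coordinate
  (\<open>compact_embedding_diagonal_subseq\<close>). What has to be excluded is that mass escapes to large
  indices. In \<open>B\<^sub>1\<close> this is impossible: the increments are summable uniformly in \<open>k\<close>, so
  \<open>e x\<^sup>k\<^sub>n\<close> is bounded uniformly in \<open>k\<close> and \<open>n\<close> (\<open>X_space_uniformly_bounded\<close>); as the weights have
  finite sum, dominated convergence makes the subsequence converge in the weighted \<open>\<ell>\<^sup>p\<close> norm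
  over \<open>B\<^sub>1\<close>. Ehrling's inequality \<open>\<parallel>i u\<parallel> \<le> \<eta> \<parallel>u\<parallel> + C \<parallel>e u\<parallel>\<close>, with \<open>\<eta>\<close> as small as desired,
  interpolates between this convergence and the bound over \<open>B\<^sub>0\<close>, and shows that
  the subsequence is Cauchy over \<open>B\<close>.
\<close>

section \<open>Completeness and compactness for norms on subspaces\<close>

lemma banach_space_onI:
  assumes N: "normed_space_on S N"
    and lim: "\<And>x. (\<And>k. x k \<in> S) \<Longrightarrow> (\<And>\<epsilon>. 0 < \<epsilon> \<Longrightarrow> \<exists>M. \<forall>k\<ge>M. \<forall>m\<ge>M. N (x k - x m) < \<epsilon>) \<Longrightarrow>
      \<exists>l\<in>S. (\<lambda>k. N (x k - l)) \<longlonglongrightarrow> 0"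
  shows "banach_space_on S N"
proof -
  interpret Metric_space S "norm_metric S N"
    by (rule Metric_space_norm_metric[OF N])
  have "\<exists>l. limitin mtopology \<sigma> l sequentially" if \<sigma>: "MCauchy \<sigma>" for \<sigma>
  proof -
    have S: "\<sigma> k \<in> S" for k
      using \<sigma> by (auto simp: MCauchy_def)
    have "\<exists>M. \<forall>k\<ge>M. \<forall>m\<ge>M. N (\<sigma> k - \<sigma> m) < \<epsilon>" if "0 < \<epsilon>" for \<epsilon>
      using \<sigma> that S unfolding MCauchy_def norm_metric_def by simp
    from lim[OF S this] obtain l where "l \<in> S" "(\<lambda>k. N (\<sigma> k - l)) \<longlonglongrightarrow> 0"
      by blast
    then show ?thesis
      using S by (auto simp: limitin_metric_dist_null norm_metric_def intro!: exI[of _ l])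
  qed
  then show ?thesis
    using N by (simp add: banach_space_on_def mcomplete_def)
qed

lemma banach_space_on_convergent:
  assumes "banach_space_on S N" and S: "\<And>k. x k \<in> S"
    and Cauchy: "\<And>\<epsilon>. 0 < \<epsilon> \<Longrightarrow> \<exists>M. \<forall>k\<ge>M. \<forall>m\<ge>M. N (x k - x m) < \<epsilon>"
  shows "\<exists>l\<in>S. (\<lambda>k. N (x k - l)) \<longlonglongrightarrow> 0"
proof -
  have N: "normed_space_on S N" and c: "Metric_space.mcomplete S (norm_metric S N)"
    using assms(1) by (auto simp: banach_space_on_def)
  interpret Metric_space S "norm_metric S N"
    by (rule Metric_space_norm_metric[OF N])
  have "MCauchy x"
    using S Cauchy unfolding MCauchy_def norm_metric_def by auto
  then obtain l where "limitin mtopology x l sequentially"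
    using c by (auto simp: mcomplete_def)
  then show ?thesis
    using S by (auto simp: limitin_metric_dist_null norm_metric_def intro!: bexI[of _ l])
qed

lemma normed_space_on_graph_norm:
  assumes N: "normed_space_on S N" and K: "normed_space_on T K" and D: "linear D"
  shows "normed_space_on {x \<in> S. D x \<in> T} (\<lambda>x. N x + K (D x))"
proof -
  have S: "subspace S" and T: "subspace T"
    and N': "\<And>x. x \<in> S \<Longrightarrow> 0 \<le> N x" "\<And>x. x \<in> S \<Longrightarrow> N x = 0 \<longleftrightarrow> x = 0"
      "\<And>c x. x \<in> S \<Longrightarrow> N (c *\<^sub>R x) = \<bar>c\<bar> * N x"
      "\<And>x y. x \<in> S \<Longrightarrow> y \<in> S \<Longrightarrow> N (x + y) \<le> N x + N y"
    and K': "\<And>x. x \<in> T \<Longrightarrow> 0 \<le> K x" "\<And>x. x \<in> T \<Longrightarrow> K x = 0 \<longleftrightarrow> x = 0"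
      "\<And>c x. x \<in> T \<Longrightarrow> K (c *\<^sub>R x) = \<bar>c\<bar> * K x"
      "\<And>x y. x \<in> T \<Longrightarrow> y \<in> T \<Longrightarrow> K (x + y) \<le> K x + K y"
    using N K unfolding normed_space_on_def by simp_all
  have "subspace {x \<in> S. D x \<in> T}"
    using S T by (auto simp: subspace_def linear_0[OF D] linear_add[OF D] linear_cmul[OF D])
  moreover have "N x + K (D x) = 0 \<longleftrightarrow> x = 0" if "x \<in> S" "D x \<in> T" for x
    using N'(1,2)[OF that(1)] K'(1,2)[OF that(2)] by (auto simp: linear_0[OF D])
  moreover have "N (x + y) + K (D (x + y)) \<le> N x + K (D x) + (N y + K (D y))"
    if "x \<in> S" "D x \<in> T" "y \<in> S" "D y \<in> T" for x y
    using N'(4)[OF that(1,3)] K'(4)[OF that(2,4)] by (simp add: linear_add[OF D])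
  ultimately show ?thesis
    unfolding normed_space_on_def
    by (simp add: N' K' linear_cmul[OF D] distrib_left)
qed

text \<open>
  A graph-norm Cauchy sequence has a limit \<open>l\<close>, and its image under \<open>D\<close> has a limit \<open>m\<close>; closedness
  of \<open>D\<close> is exactly what identifies \<open>D l\<close> with \<open>m\<close> and so puts \<open>l\<close> into the domain.
\<close>

lemma banach_space_on_graph_norm:
  assumes N: "banach_space_on S N" and K: "banach_space_on T K" and D: "linear D"
    and closed: "\<And>(x :: nat \<Rightarrow> _) l m. (\<And>k. x k \<in> S) \<Longrightarrow> (\<And>k. D (x k) \<in> T) \<Longrightarrow> l \<in> S \<Longrightarrow> m \<in> T \<Longrightarrow>
      (\<lambda>k. N (x k - l)) \<longlonglongrightarrow> 0 \<Longrightarrow> (\<lambda>k. K (D (x k) - m)) \<longlonglongrightarrow> 0 \<Longrightarrow> D l = m"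
  shows "banach_space_on {x \<in> S. D x \<in> T} (\<lambda>x. N x + K (D x))"
proof (rule banach_space_onI)
  have N': "normed_space_on S N" and K': "normed_space_on T K"
    using N K by (auto simp: banach_space_on_def)
  then show "normed_space_on {x \<in> S. D x \<in> T} (\<lambda>x. N x + K (D x))"
    by (rule normed_space_on_graph_norm[OF _ _ D])
  fix x :: "nat \<Rightarrow> 'a"
  assume x: "\<And>k. x k \<in> {x \<in> S. D x \<in> T}"
    and C: "\<And>\<epsilon>. 0 < \<epsilon> \<Longrightarrow> \<exists>M. \<forall>k\<ge>M. \<forall>m\<ge>M. N (x k - x m) + K (D (x k - x m)) < \<epsilon>"
  have xS: "x k \<in> S" and xT: "D (x k) \<in> T" for k
    using x by auto
  have pos: "0 \<le> N (x k - x m)" "0 \<le> K (D (x k) - D (x m))" for k m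
    using N' K' subspace_diff[OF _ xS xS] subspace_diff[OF _ xT xT] unfolding normed_space_on_def by simp_all
  have "\<exists>M. \<forall>k\<ge>M. \<forall>m\<ge>M. N (x k - x m) < \<epsilon>"
    and "\<exists>M. \<forall>k\<ge>M. \<forall>m\<ge>M. K (D (x k) - D (x m)) < \<epsilon>" if "0 < \<epsilon>" for \<epsilon>
    using C[OF that] pos unfolding linear_diff[OF D]
    by (meson add_increasing add_increasing2 le_less_trans order_refl)+
  then obtain l m where l: "l \<in> S" "(\<lambda>k. N (x k - l)) \<longlonglongrightarrow> 0"
    and m: "m \<in> T" "(\<lambda>k. K (D (x k) - m)) \<longlonglongrightarrow> 0"
    using banach_space_on_convergent[OF N, of x, OF xS]
      banach_space_on_convergent[OF K, of "\<lambda>k. D (x k)", OF xT] by blast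
  have "D l = m"
    using closed[OF xS xT l(1) m(1) l(2) m(2)] .
  then show "\<exists>l\<in>{x \<in> S. D x \<in> T}. (\<lambda>k. N (x k - l) + K (D (x k - l))) \<longlonglongrightarrow> 0"
    using l m tendsto_add[OF l(2) m(2)]
    by (intro bexI[of _ l]) (simp_all add: linear_diff[OF D])
qed

text \<open>
  In a complete metric space relative compactness is total boundedness, and the latter only asks for
  Cauchy subsequences; no limit in \<open>T\<close> has to be exhibited.
\<close>

lemma compact_linear_map_onI:
  assumes N: "normed_space_on S N" and K: "banach_space_on T K"
    and f: "linear f" "f ` S \<subseteq> T"
    and subseq: "\<And>(x :: nat \<Rightarrow> _) c. (\<And>k. x k \<in> S) \<Longrightarrow> (\<And>k. N (x k) \<le> c) \<Longrightarrow>
      \<exists>r. strict_mono (r :: nat \<Rightarrow> nat) \<and>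
        (\<forall>\<epsilon>>0. \<exists>M. \<forall>k\<ge>M. \<forall>m\<ge>M. K (f (x (r k)) - f (x (r m))) < \<epsilon>)"
  shows "compact_linear_map_on S N T K f"
proof -
  have K': "normed_space_on T K" and c: "Metric_space.mcomplete T (norm_metric T K)"
    using K by (auto simp: banach_space_on_def)
  interpret Metric_space T "norm_metric T K"
    by (rule Metric_space_norm_metric[OF K'])
  have "compactin mtopology (mtopology closure_of (f ` A))"
    if A: "A \<subseteq> S" "\<forall>x\<in>A. N x \<le> c" for A c
  proof -
    have "\<exists>r. strict_mono r \<and> MCauchy (\<sigma> \<circ> r)" if \<sigma>: "range \<sigma> \<subseteq> f ` A" for \<sigma> :: "nat \<Rightarrow> _"
    proof -
      have "\<forall>k. \<exists>a\<in>A. \<sigma> k = f a"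
        using \<sigma> by blast
      then obtain x where x: "\<And>k. x k \<in> A" "\<And>k. \<sigma> k = f (x k)"
        by metis
      have "x k \<in> S" "N (x k) \<le> c" for k
        using x(1) A by auto
      from subseq[of x, OF this] obtain r where r: "strict_mono (r :: nat \<Rightarrow> nat)"
        and C: "\<forall>\<epsilon>>0. \<exists>M. \<forall>k\<ge>M. \<forall>m\<ge>M. K (f (x (r k)) - f (x (r m))) < \<epsilon>"
        by blast
      have "f (x k) \<in> T" for k
        using x(1) A f by blast
      then have "MCauchy (\<sigma> \<circ> r)"
        using C by (auto simp: MCauchy_def norm_metric_def x(2))
      with r show ?thesis
        by blast
    qed
    then have "mtotally_bounded (f ` A)"
      using A(1) f(2) unfolding mtotally_bounded_sequentially by blast
    then show ?thesis
      using mtotally_bounded_eq_compact_closure_of[OF c] by blast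
  qed
  then show ?thesis
    using N K' f unfolding compact_linear_map_on_def by blast
qed


section \<open>Weighted sequence spaces\<close>

lemma suminf_eq_weighted_lp_norm_powr:
  assumes "\<forall>n. 0 \<le> w n" and "1 \<le> p" and "x \<in> weighted_lp_space w p"
  shows "(\<Sum>n. w n * norm (x n) powr p) = weighted_lp_norm w p x powr p"
proof -
  have "0 \<le> (\<Sum>n. w n * norm (x n) powr p)"
    using assms by (intro suminf_nonneg) (auto simp: weighted_lp_space_def)
  then show ?thesis
    using assms(2) by (simp add: weighted_lp_norm_def powr_powr)
qed

lemma sum_le_weighted_lp_norm_powr:
  assumes "\<forall>n. 0 \<le> w n" and "1 \<le> p" and "x \<in> weighted_lp_space w p"
  shows "(\<Sum>n<M. w n * norm (x n) powr p) \<le> weighted_lp_norm w p x powr p"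
  unfolding suminf_eq_weighted_lp_norm_powr[OF assms, symmetric]
  using assms by (intro sum_le_suminf) (auto simp: weighted_lp_space_def)

text \<open>
  Stated with finite partial sums, because these can be compared term by term, split and passed
  to the limit before anything is known about summability.
\<close>

lemma weighted_lp_norm_leI:
  assumes "\<forall>n. 0 \<le> w n" and "1 \<le> p" and "0 \<le> c"
    and le: "\<And>M. (\<Sum>n<M. w n * norm (x n) powr p) \<le> c powr p"
  shows "x \<in> weighted_lp_space w p" and "weighted_lp_norm w p x \<le> c"
proof -
  have s: "summable (\<lambda>n. w n * norm (x n) powr p)"
    using assms by (intro summableI_nonneg_bounded[OF _ le]) auto
  then show "x \<in> weighted_lp_space w p"
    by (simp add: weighted_lp_space_def)
  have "weighted_lp_norm w p x \<le> (c powr p) powr (1 / p)"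
    unfolding weighted_lp_norm_def using assms s
    by (intro powr_mono2 suminf_le_const[OF s le] suminf_nonneg[OF s]) auto
  then show "weighted_lp_norm w p x \<le> c"
    using assms by (simp add: powr_powr)
qed

lemma weighted_lp_norm_mono:
  assumes w: "\<forall>n. 0 \<le> w n" and p: "1 \<le> p" and y: "y \<in> weighted_lp_space w p"
    and le: "\<And>n. norm (x n) \<le> norm (y n)"
  shows "x \<in> weighted_lp_space w p" and "weighted_lp_norm w p x \<le> weighted_lp_norm w p y"
proof -
  have "(\<Sum>n<M. w n * norm (x n) powr p) \<le> weighted_lp_norm w p y powr p" for M
  proof -
    have "(\<Sum>n<M. w n * norm (x n) powr p) \<le> (\<Sum>n<M. w n * norm (y n) powr p)"
      using w p le by (intro sum_mono mult_left_mono powr_mono2) auto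
    also have "\<dots> \<le> weighted_lp_norm w p y powr p"
      by (rule sum_le_weighted_lp_norm_powr[OF w p y])
    finally show ?thesis .
  qed
  moreover have "0 \<le> weighted_lp_norm w p y"
    by (simp add: weighted_lp_norm_def)
  ultimately show "x \<in> weighted_lp_space w p" "weighted_lp_norm w p x \<le> weighted_lp_norm w p y"
    using weighted_lp_norm_leI[OF w p, of "weighted_lp_norm w p y" x] by simp_all
qed

lemma weighted_lp_norm_coordinate:
  assumes w: "\<forall>n. 0 < w n" and p: "1 \<le> p" and x: "x \<in> weighted_lp_space w p"
  shows "norm (x n) \<le> w n powr (- 1 / p) * weighted_lp_norm w p x"
proof -
  have w': "\<forall>n. 0 \<le> w n"
    using w by (simp add: less_imp_le)
  have "w n * norm (x n) powr p \<le> (\<Sum>n<Suc n. w n * norm (x n) powr p)"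
    using w' by (auto intro!: sum_nonneg)
  also have "\<dots> \<le> weighted_lp_norm w p x powr p"
    by (rule sum_le_weighted_lp_norm_powr[OF w' p x])
  finally have "norm (x n) powr p \<le> w n powr (- 1) * weighted_lp_norm w p x powr p"
    using w[rule_format, of n] by (simp add: powr_minus field_simps)
  then have "(norm (x n) powr p) powr (1 / p)
      \<le> (w n powr (- 1) * weighted_lp_norm w p x powr p) powr (1 / p)"
    using p by (intro powr_mono2) auto
  also have "\<dots> = (w n powr (- 1)) powr (1 / p) * (weighted_lp_norm w p x powr p) powr (1 / p)"
    by (rule powr_mult)
  also have "\<dots> = w n powr (- 1 / p) * weighted_lp_norm w p x"
    using p by (simp only: powr_powr) (simp add: weighted_lp_norm_def)
  finally show ?thesis
    using p by (simp add: powr_powr)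
qed

text \<open>
  On the open half-line this is convexity of \<open>x \<mapsto> x\<^sup>p\<close>. When \<open>a\<close> or \<open>b\<close> vanishes, it reduces to
  \<open>s\<^sup>p \<le> s\<close> for \<open>0 \<le> s \<le> 1\<close>.
\<close>

lemma powr_convex_combination:
  fixes a b t p :: real
  assumes "1 \<le> p" "0 \<le> a" "0 \<le> b" "0 \<le> t" "t \<le> 1"
  shows "((1 - t) * a + t * b) powr p \<le> (1 - t) * a powr p + t * b powr p"
proof -
  have shrink: "(s * c) powr p \<le> s * c powr p" if "0 \<le> s" "s \<le> 1" "0 \<le> c" for s c
    using powr_mono'[of 1 p s] assms(1) that by (simp add: powr_mult mult_right_mono)
  consider "a = 0" | "b = 0" | "0 < a" "0 < b"
    using assms by fastforce
  then show ?thesis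
  proof cases
    case 1
    then show ?thesis using shrink[of t b] assms by simp
  next
    case 2
    then show ?thesis using shrink[of "1 - t" a] assms by simp
  next
    case 3
    then show ?thesis
      using convex_onD[OF powr_convex[OF assms(1)], of t a b] assms by simp
  qed
qed

text \<open>
  Minkowski's inequality expresses convexity of the unit ball. With \<open>a\<close> and \<open>b\<close> the norms of \<open>x\<close> and
  \<open>y\<close>, the sequence \<open>(x + y) / (a + b)\<close> is the convex combination of \<open>x / a\<close> and \<open>y / b\<close> with
  coefficients \<open>a / (a + b)\<close> and \<open>b / (a + b)\<close>, and convexity of the \<open>p\<close>-th power applies at each
  coordinate.
\<close>

lemma weighted_lp_triangle:
  assumes w: "\<forall>n. 0 < w n" and p: "1 \<le> p"
    and x: "x \<in> weighted_lp_space w p" and y: "y \<in> weighted_lp_space w p"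
  shows "x + y \<in> weighted_lp_space w p"
    and "weighted_lp_norm w p (x + y) \<le> weighted_lp_norm w p x + weighted_lp_norm w p y"
proof -
  have w': "\<forall>n. 0 \<le> w n"
    using w by (simp add: less_imp_le)
  define a where "a = weighted_lp_norm w p x"
  define b where "b = weighted_lp_norm w p y"
  have nonneg: "0 \<le> a" "0 \<le> b"
    by (simp_all add: a_def b_def weighted_lp_norm_def)
  have zero: "z = 0" if "weighted_lp_norm w p z = 0" "z \<in> weighted_lp_space w p" for z :: "nat \<Rightarrow> 'a"
    using weighted_lp_norm_coordinate[OF w p that(2)] that(1) by (auto simp: fun_eq_iff)
  have "x + y \<in> weighted_lp_space w p \<and> weighted_lp_norm w p (x + y) \<le> a + b"
  proof (cases "a = 0 \<or> b = 0")
    case True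
    then show ?thesis
      using zero[OF _ x] zero[OF _ y] x y nonneg by (auto simp: a_def b_def)
  next
    case False
    then have ab: "0 < a" "0 < b"
      using nonneg by auto
    define t where "t = b / (a + b)"
    have t: "0 \<le> t" "t \<le> 1" "1 - t = a / (a + b)"
      using ab by (auto simp: t_def field_simps)
    have pt: "norm ((x + y) n) powr p \<le>
        (a + b) powr p * ((1 - t) * (norm (x n) powr p / a powr p) + t * (norm (y n) powr p / b powr p))" for n
    proof -
      have "norm ((x + y) n) powr p \<le> (norm (x n) + norm (y n)) powr p"
        using p by (intro powr_mono2) (auto simp: norm_triangle_ineq)
      also have "norm (x n) + norm (y n) = (a + b) * ((1 - t) * (norm (x n) / a) + t * (norm (y n) / b))"
      proof -
        have "(a + b) * (1 - t) = a" "(a + b) * t = b"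
          using ab unfolding t(3) by (simp_all add: t_def)
        then have "(a + b) * ((1 - t) * (norm (x n) / a) + t * (norm (y n) / b))
            = a * (norm (x n) / a) + b * (norm (y n) / b)"
          by (simp only: distrib_left mult.assoc[symmetric])
        then show ?thesis
          using ab by simp
      qed
      also have "\<dots> powr p = (a + b) powr p * ((1 - t) * (norm (x n) / a) + t * (norm (y n) / b)) powr p"
        by (rule powr_mult)
      also have "\<dots> \<le> (a + b) powr p * ((1 - t) * (norm (x n) / a) powr p + t * (norm (y n) / b) powr p)"
        using p ab t by (intro mult_left_mono powr_convex_combination) auto
      finally show ?thesis
        by (simp add: powr_divide)
    qed
    have "(\<Sum>n<M. w n * norm ((x + y) n) powr p) \<le> (a + b) powr p" for M
    proof -
      let ?X = "\<Sum>n<M. w n * norm (x n) powr p" and ?Y = "\<Sum>n<M. w n * norm (y n) powr p"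
      have "(\<Sum>n<M. w n * norm ((x + y) n) powr p) \<le> (\<Sum>n<M. w n *
        ((a + b) powr p * ((1 - t) * (norm (x n) powr p / a powr p) + t * (norm (y n) powr p / b powr p))))"
        by (intro sum_mono mult_left_mono pt w'[rule_format])
      also have "\<dots> = (a + b) powr p * ((1 - t) * (?X / a powr p) + t * (?Y / b powr p))"
        by (simp add: sum_distrib_left sum_divide_distrib sum.distrib[symmetric] algebra_simps)
      also have "\<dots> \<le> (a + b) powr p * ((1 - t) * 1 + t * 1)"
        using sum_le_weighted_lp_norm_powr[OF w' p x, of M]
          sum_le_weighted_lp_norm_powr[OF w' p y, of M] t ab
        by (intro mult_left_mono add_mono) (auto simp: a_def b_def divide_le_eq_1)
      finally show ?thesis
        by simp
    qed
    then show ?thesis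
      using weighted_lp_norm_leI[OF w' p, of "a + b" "x + y"] nonneg by simp
  qed
  then show "x + y \<in> weighted_lp_space w p"
    "weighted_lp_norm w p (x + y) \<le> weighted_lp_norm w p x + weighted_lp_norm w p y"
    by (simp_all add: a_def b_def)
qed

lemma weighted_lp_diff:
  assumes w: "\<forall>n. 0 < w n" and p: "1 \<le> p"
    and x: "x \<in> weighted_lp_space w p" and y: "y \<in> weighted_lp_space w p"
  shows "x - y \<in> weighted_lp_space w p"
    and "weighted_lp_norm w p (x - y) \<le> weighted_lp_norm w p x + weighted_lp_norm w p y"
proof -
  have "- y \<in> weighted_lp_space w p" "weighted_lp_norm w p (- y) = weighted_lp_norm w p y"
    using y by (simp_all add: weighted_lp_space_def weighted_lp_norm_def)
  then show "x - y \<in> weighted_lp_space w p"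
    "weighted_lp_norm w p (x - y) \<le> weighted_lp_norm w p x + weighted_lp_norm w p y"
    using weighted_lp_triangle[OF w p x, of "- y"] by simp_all
qed

lemma normed_space_on_weighted_lp:
  assumes w: "\<forall>n. 0 < w n" and p: "1 \<le> p"
  shows "normed_space_on (weighted_lp_space w p :: (nat \<Rightarrow> 'b::real_normed_vector) set)
    (weighted_lp_norm w p)"
proof -
  let ?S = "weighted_lp_space w p :: (nat \<Rightarrow> 'b) set"
  have w': "\<forall>n. 0 \<le> w n"
    using w by (simp add: less_imp_le)
  have zero: "0 \<in> ?S" "weighted_lp_norm w p (0 :: nat \<Rightarrow> 'b) = 0"
    using p by (simp_all add: weighted_lp_space_def weighted_lp_norm_def)
  have scale: "w n * norm ((c *\<^sub>R x) n) powr p = \<bar>c\<bar> powr p * (w n * norm (x n) powr p)"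
    for c n and x :: "nat \<Rightarrow> 'b"
    by (simp add: scaleR_fun_def powr_mult)
  have mem: "c *\<^sub>R x \<in> ?S" if "x \<in> ?S" for c x
    using that unfolding weighted_lp_space_def mem_Collect_eq scale by (rule summable_mult)
  have "weighted_lp_norm w p (c *\<^sub>R x) = \<bar>c\<bar> * weighted_lp_norm w p x" if "x \<in> ?S" for c x
  proof -
    have "0 \<le> (\<Sum>n. w n * norm (x n) powr p)"
      using that w' by (intro suminf_nonneg) (auto simp: weighted_lp_space_def)
    then show ?thesis
      using that p unfolding weighted_lp_norm_def scale
      by (subst suminf_mult) (auto simp: weighted_lp_space_def powr_mult powr_powr)
  qed
  moreover have "x = 0" if "x \<in> ?S" "weighted_lp_norm w p x = 0" for x
    using weighted_lp_norm_coordinate[OF w p that(1)] that(2) by (auto simp: fun_eq_iff)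
  moreover have "subspace ?S"
    using zero mem weighted_lp_triangle(1)[OF w p] by (auto simp: subspace_def)
  moreover have "0 \<le> weighted_lp_norm w p x" for x :: "nat \<Rightarrow> 'b"
    by (simp add: weighted_lp_norm_def)
  ultimately show ?thesis
    using zero weighted_lp_triangle(2)[OF w p] unfolding normed_space_on_def by blast
qed

lemma weighted_lp_tendsto_coordinate:
  fixes x :: "nat \<Rightarrow> nat \<Rightarrow> 'b::real_normed_vector" and w :: "nat \<Rightarrow> real"
  assumes w: "\<forall>n. 0 < w n" and p: "1 \<le> p"
    and x: "\<And>k. x k - l \<in> weighted_lp_space w p"
    and lim: "(\<lambda>k. weighted_lp_norm w p (x k - l)) \<longlonglongrightarrow> 0"
  shows "(\<lambda>k. x k n) \<longlonglongrightarrow> l n"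
proof -
  have "(\<lambda>k. x k n - l n) \<longlonglongrightarrow> 0"
  proof (rule Lim_null_comparison)
    show "\<forall>\<^sub>F k in sequentially. norm (x k n - l n) \<le> w n powr (- 1 / p) * weighted_lp_norm w p (x k - l)"
      using weighted_lp_norm_coordinate[OF w p x] by simp
    show "(\<lambda>k. w n powr (- 1 / p) * weighted_lp_norm w p (x k - l)) \<longlonglongrightarrow> 0"
      using tendsto_mult_left[OF lim] by simp
  qed
  then show ?thesis
    by (rule LIM_zero_cancel)
qed

text \<open>
  The coordinatewise limit is the norm limit by Fatou's argument: each finite partial sum of
  \<open>x k - x m\<close> is small, and \<open>m\<close> tends to infinity inside it.
\<close>

lemma banach_space_on_weighted_lp:
  assumes w: "\<forall>n. 0 < w n" and p: "1 \<le> p"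
  shows "banach_space_on (weighted_lp_space w p :: (nat \<Rightarrow> 'b::banach) set) (weighted_lp_norm w p)"
proof (rule banach_space_onI)
  let ?S = "weighted_lp_space w p :: (nat \<Rightarrow> 'b) set" and ?N = "weighted_lp_norm w p :: (nat \<Rightarrow> 'b) \<Rightarrow> real"
  have w': "\<forall>n. 0 \<le> w n"
    using w by (simp add: less_imp_le)
  show normed: "normed_space_on ?S ?N"
    by (rule normed_space_on_weighted_lp[OF w p])
  then have sub: "subspace ?S"
    by (simp add: normed_space_on_def)
  fix x :: "nat \<Rightarrow> nat \<Rightarrow> 'b"
  assume x: "\<And>k. x k \<in> ?S"
    and C: "\<And>\<epsilon>. 0 < \<epsilon> \<Longrightarrow> \<exists>M. \<forall>k\<ge>M. \<forall>m\<ge>M. ?N (x k - x m) < \<epsilon>"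
  have diff: "x k - x m \<in> ?S" for k m
    using subspace_diff[OF sub x x] .
  have "Cauchy (\<lambda>k. x k n)" for n
  proof (rule metric_CauchyI)
    fix \<epsilon> :: real assume \<epsilon>: "0 < \<epsilon>"
    define s where "s = w n powr (- 1 / p)"
    have s: "0 < s"
      using w[rule_format, of n] by (simp add: s_def)
    obtain M where M: "\<forall>k\<ge>M. \<forall>m\<ge>M. ?N (x k - x m) < \<epsilon> / s"
      using C[of "\<epsilon> / s"] \<epsilon> s by auto
    have "dist (x k n) (x m n) < \<epsilon>" if "M \<le> k" "M \<le> m" for k m
    proof -
      have "dist (x k n) (x m n) \<le> s * ?N (x k - x m)"
        using weighted_lp_norm_coordinate[OF w p diff, of k m n] by (simp add: dist_norm s_def)
      also have "\<dots> < s * (\<epsilon> / s)"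
        using M that s by (intro mult_strict_left_mono) auto
      finally show ?thesis
        using s by simp
    qed
    then show "\<exists>M. \<forall>k\<ge>M. \<forall>m\<ge>M. dist (x k n) (x m n) < \<epsilon>"
      by blast
  qed
  then have "\<exists>l. (\<lambda>k. x k n) \<longlonglongrightarrow> l" for n
    using Cauchy_convergent convergent_def by blast
  then obtain l where l: "\<And>n. (\<lambda>k. x k n) \<longlonglongrightarrow> l n"
    by metis
  have close: "x k - l \<in> ?S \<and> ?N (x k - l) \<le> \<epsilon>"
    if M: "\<forall>k\<ge>M. \<forall>m\<ge>M. ?N (x k - x m) < \<epsilon>" and k: "M \<le> k" and \<epsilon>: "0 < \<epsilon>" for M k \<epsilon>
  proof -
    have "(\<Sum>n<L. w n * norm ((x k - l) n) powr p) \<le> \<epsilon> powr p" for L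
    proof (rule tendsto_upperbound)
      show "(\<lambda>m. \<Sum>n<L. w n * norm ((x k - x m) n) powr p)
          \<longlonglongrightarrow> (\<Sum>n<L. w n * norm ((x k - l) n) powr p)"
        using p l by (auto intro!: tendsto_intros)
      have "(\<Sum>n<L. w n * norm ((x k - x m) n) powr p) \<le> \<epsilon> powr p" if "M \<le> m" for m
      proof -
        have "(\<Sum>n<L. w n * norm ((x k - x m) n) powr p) \<le> ?N (x k - x m) powr p"
          by (rule sum_le_weighted_lp_norm_powr[OF w' p diff])
        also have "\<dots> \<le> \<epsilon> powr p"
          using M k that p by (intro powr_mono2) (auto simp: weighted_lp_norm_def less_imp_le)
        finally show ?thesis .
      qed
      then show "\<forall>\<^sub>F m in sequentially. (\<Sum>n<L. w n * norm ((x k - x m) n) powr p) \<le> \<epsilon> powr p"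
        by (auto simp: eventually_sequentially)
    qed simp
    then show ?thesis
      using weighted_lp_norm_leI[OF w' p less_imp_le[OF \<epsilon>], of "x k - l"] by simp
  qed
  obtain k where "x k - l \<in> ?S"
    using C[of 1] close by (metis order_refl zero_less_one)
  then have "l \<in> ?S"
    using subspace_diff[OF sub x[of k], of "x k - l"] by simp
  moreover have "(\<lambda>k. ?N (x k - l)) \<longlonglongrightarrow> 0"
  proof (rule LIMSEQ_I)
    fix \<epsilon> :: real assume "0 < \<epsilon>"
    then have \<epsilon>: "0 < \<epsilon> / 2"
      by simp
    obtain M where M: "\<forall>k\<ge>M. \<forall>m\<ge>M. ?N (x k - x m) < \<epsilon> / 2"
      using C[OF \<epsilon>] by blast
    have "norm (?N (x k - l) - 0) < \<epsilon>" if "M \<le> k" for k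
      using close[OF M that \<epsilon>] \<epsilon> by (simp add: weighted_lp_norm_def)
    then show "\<exists>M. \<forall>k\<ge>M. norm (?N (x k - l) - 0) < \<epsilon>"
      by blast
  qed
  ultimately show "\<exists>l\<in>?S. (\<lambda>k. ?N (x k - l)) \<longlonglongrightarrow> 0"
    by blast
qed

lemma weighted_lp_bounded:
  assumes w: "\<forall>n. 0 \<le> w n" "summable w" and p: "1 \<le> p" and x: "\<And>n. norm (x n) \<le> C"
  shows "x \<in> weighted_lp_space w p"
  unfolding weighted_lp_space_def mem_Collect_eq
proof (rule summable_comparison_test')
  show "summable (\<lambda>n. w n * C powr p)"
    using w(2) by (rule summable_mult2)
  show "norm (w n * norm (x n) powr p) \<le> w n * C powr p" if "0 \<le> n" for n
    using w(1)[rule_format, of n] p x[of n] by (auto intro!: mult_left_mono powr_mono2)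
qed

text \<open>The weights define a finite measure, so constants are admissible dominating functions.\<close>

lemma weighted_lp_dominated_convergence:
  fixes x :: "nat \<Rightarrow> nat \<Rightarrow> 'b::real_normed_vector" and w :: "nat \<Rightarrow> real"
  assumes w: "\<forall>n. 0 \<le> w n" "summable w" and p: "1 \<le> p"
    and bound: "\<And>k n. norm (x k n) \<le> C" and lim: "\<And>n. (\<lambda>k. x k n) \<longlonglongrightarrow> 0"
  shows "(\<lambda>k. weighted_lp_norm w p (x k)) \<longlonglongrightarrow> 0"
proof -
  have "(\<lambda>k. \<Sum>n. w n * norm (x k n) powr p) \<longlonglongrightarrow> (\<Sum>n. 0)"
  proof (rule conjunct2[OF conjunct2[OF tannerys_theorem]])
    show "(\<lambda>k. w n * norm (x k n) powr p) \<longlonglongrightarrow> 0" for n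
      using p tendsto_powr'[OF tendsto_norm_zero[OF lim[of n]] tendsto_const[of p]]
      by (intro tendsto_mult_right_zero) simp
    show "summable (\<lambda>n. w n * C powr p)"
      using w(2) by (rule summable_mult2)
    show "\<forall>\<^sub>F (n, k) in sequentially \<times>\<^sub>F sequentially. norm (w n * norm (x k n) powr p) \<le> w n * C powr p"
      using w(1) p bound by (intro always_eventually) (auto intro!: mult_left_mono powr_mono2)
  qed simp
  then have "(\<lambda>k. (\<Sum>n. w n * norm (x k n) powr p) powr (1 / p)) \<longlonglongrightarrow> 0 powr (1 / p)"
    using p w by (intro tendsto_powr')
      (auto intro!: always_eventually suminf_nonneg weighted_lp_bounded[unfolded weighted_lp_space_def mem_Collect_eq, OF w p bound])
  then show ?thesis
    using p by (simp add: weighted_lp_norm_def)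
qed


section \<open>Compact embeddings\<close>

lemma compact_embedding_subseq:
  assumes i: "compact_embedding i" and b: "\<And>k. norm (u k) \<le> c"
  obtains r l where "strict_mono (r :: nat \<Rightarrow> nat)" "(\<lambda>k. i (u (r k))) \<longlonglongrightarrow> l"
proof -
  have "bounded (range u)"
    using b by (auto simp: bounded_iff)
  then have "compact (closure (i ` range u))"
    using i by (auto simp: compact_embedding_def)
  then have "seq_compact (closure (i ` range u))"
    by (rule compact_imp_seq_compact)
  moreover have "\<forall>k. i (u k) \<in> closure (i ` range u)"
    by (auto intro!: subsetD[OF closure_subset])
  ultimately show ?thesis
    by (rule seq_compactE) (use that in \<open>auto simp: o_def\<close>)
qed

text \<open>
  If the inequality failed for \<open>C = m\<close> and every \<open>m\<close>, the counterexamples, scaled to \<open>\<parallel>i v\<parallel> = 1\<close>,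
  would be bounded by \<open>1 / \<eta>\<close> and satisfy \<open>\<parallel>j (i v)\<parallel> < 1 / m\<close>. By compactness a subsequence of their
  images converges to a unit vector, which \<open>j\<close> maps to \<open>0\<close>, against injectivity.
\<close>

lemma Ehrling:
  assumes i: "compact_embedding i" and j: "continuous_embedding j" and \<eta>: "0 < (\<eta>::real)"
  obtains C where "0 \<le> C" "\<And>u. norm (i u) \<le> \<eta> * norm u + C * norm (j (i u))"
proof -
  have il: "bounded_linear i" and jl: "bounded_linear j" "inj j"
    using i j by (auto simp: compact_embedding_def continuous_embedding_def)
  interpret i: bounded_linear i by fact
  interpret j: bounded_linear j by fact
  have "\<exists>m::nat. \<forall>u. norm (i u) \<le> \<eta> * norm u + real m * norm (j (i u))"
  proof (rule ccontr)
    assume "\<not> ?thesis"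
    then have "\<forall>m::nat. \<exists>u. \<eta> * norm u + real m * norm (j (i u)) < norm (i u)"
      by (simp add: not_le)
    then obtain u where u: "\<And>m. \<eta> * norm (u m) + real m * norm (j (i (u m))) < norm (i (u m))"
      by metis
    have nz: "0 < norm (i (u m))" for m
      using u[of m] \<eta> by (smt (verit) mult_nonneg_nonneg norm_ge_zero of_nat_0_le_iff)
    define v where "v m = u m /\<^sub>R norm (i (u m))" for m
    have v1: "norm (i (v m)) = 1" for m
      using nz[of m] by (simp add: v_def i.scaleR)
    have v: "\<eta> * norm (v m) + real m * norm (j (i (v m))) < 1" for m
      using u[of m] nz[of m] by (simp add: v_def i.scaleR j.scaleR field_simps)
    have "norm (v m) \<le> 1 / \<eta>" for m
    proof -
      have "0 \<le> real m * norm (j (i (v m)))"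
        by simp
      then have "\<eta> * norm (v m) \<le> 1"
        using v[of m] by linarith
      then show ?thesis
        using \<eta> by (simp add: field_simps)
    qed
    then obtain r l where r: "strict_mono (r :: nat \<Rightarrow> nat)" and l: "(\<lambda>k. i (v (r k))) \<longlonglongrightarrow> l"
      using compact_embedding_subseq[OF i] by blast
    have "norm l = 1"
      using tendsto_norm[OF l] by (simp add: v1 LIMSEQ_const_iff)
    moreover have "(\<lambda>m. j (i (v m))) \<longlonglongrightarrow> 0"
    proof (rule Lim_null_comparison)
      show "\<forall>\<^sub>F m in sequentially. norm (j (i (v m))) \<le> 1 / real m"
      proof (rule eventually_mono[OF eventually_gt_at_top[of 0]])
        fix m :: nat assume "0 < m"
        moreover have "0 \<le> \<eta> * norm (v m)"
          using \<eta> by simp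
        ultimately show "norm (j (i (v m))) \<le> 1 / real m"
          using v[of m] by (simp add: field_simps)
      qed
      show "(\<lambda>m. 1 / real m) \<longlonglongrightarrow> 0"
        by (rule lim_1_over_n)
    qed
    then have "(\<lambda>k. j (i (v (r k)))) \<longlonglongrightarrow> 0"
      using LIMSEQ_subseq_LIMSEQ[OF _ r] by (fastforce simp: o_def)
    then have "j l = 0"
      using LIMSEQ_unique j.tendsto[OF l] by blast
    then have "l = 0"
      using jl(2) j.zero by (metis injD)
    ultimately show False
      by simp
  qed
  then show ?thesis
    using that of_nat_0_le_iff by blast
qed

lemma compact_embedding_diagonal_subseq:
  fixes x :: "nat \<Rightarrow> nat \<Rightarrow> 'a::real_normed_vector"
  assumes i: "compact_embedding i" and b: "\<And>k n. norm (x k n) \<le> c n"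
  obtains r y where "strict_mono (r :: nat \<Rightarrow> nat)" "\<And>n. (\<lambda>k. i (x (r k) n)) \<longlonglongrightarrow> y n"
proof -
  interpret subseqs "\<lambda>n s. \<exists>l. (\<lambda>k. i (x (s k) n)) \<longlonglongrightarrow> l"
  proof
    fix n and s :: "nat \<Rightarrow> nat"
    obtain r l where "strict_mono (r :: nat \<Rightarrow> nat)" "(\<lambda>k. i (x (s (r k)) n)) \<longlonglongrightarrow> l"
      using compact_embedding_subseq[OF i, of "\<lambda>k. x (s k) n"] b by blast
    then show "\<exists>r. strict_mono r \<and> (\<exists>l. (\<lambda>k. i (x ((s \<circ> r) k) n)) \<longlonglongrightarrow> l)"
      by auto
  qed
  have "\<exists>l. (\<lambda>k. i (x ((diagseq \<circ> ((+) (Suc n))) k) n)) \<longlonglongrightarrow> l" for n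
  proof (rule diagseq_holds)
    fix r s :: "nat \<Rightarrow> nat" and n
    assume "strict_mono r" "\<exists>l. (\<lambda>k. i (x (s k) n)) \<longlonglongrightarrow> l"
    then show "\<exists>l. (\<lambda>k. i (x ((s \<circ> r) k) n)) \<longlonglongrightarrow> l"
      using LIMSEQ_subseq_LIMSEQ by (fastforce simp: o_def)
  qed
  \<comment> \<open>The diagonal sequence is a subsequence of the \<open>n\<close>-th refinement only from index \<open>n + 1\<close> on.\<close>
  then have "\<forall>n. \<exists>l. (\<lambda>k. i (x (diagseq (k + Suc n)) n)) \<longlonglongrightarrow> l"
    by (simp add: o_def add.commute)
  then obtain y where "\<forall>n. (\<lambda>k. i (x (diagseq (k + Suc n)) n)) \<longlonglongrightarrow> y n"
    by (rule choice[THEN exE])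
  then have "(\<lambda>k. i (x (diagseq k) n)) \<longlonglongrightarrow> y n" for n
    using LIMSEQ_offset[of "\<lambda>k. i (x (diagseq k) n)" "Suc n"] by simp
  then show ?thesis
    using that subseq_diagseq by blast
qed


section \<open>The space of sequences with controlled increments\<close>

lemma linear_increments:
  assumes "linear e"
  shows "linear (\<lambda>x n. e (x (Suc n) - x n))"
  by (rule linearI)
    (auto simp: fun_eq_iff scaleR_fun_def linear_diff[OF assms] linear_add[OF assms] linear_cmul[OF assms]
      algebra_simps)

lemma linear_pointwise:
  assumes "linear f"
  shows "linear (\<lambda>x n. f (x n))"
  by (rule linearI) (auto simp: fun_eq_iff scaleR_fun_def linear_add[OF assms] linear_cmul[OF assms])

lemma X_space_eq:
  "X_space e \<alpha> p0 p1 = {x \<in> weighted_lp_space \<alpha> p0.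
    (\<lambda>n. e (x (Suc n) - x n)) \<in> weighted_lp_space (\<lambda>n. \<alpha> n powr (1 - p1)) p1}"
  by (auto simp: X_space_def weighted_lp_space_def)

lemma X_norm_eq:
  "X_norm e \<alpha> p0 p1 x = weighted_lp_norm \<alpha> p0 x
    + weighted_lp_norm (\<lambda>n. \<alpha> n powr (1 - p1)) p1 (\<lambda>n. e (x (Suc n) - x n))"
  by (simp add: X_norm_def weighted_lp_norm_def)

lemma banach_space_on_X_space:
  fixes e :: "'b0::banach \<Rightarrow> 'b1::banach"
  assumes e: "bounded_linear e" and p: "1 \<le> p0" "1 \<le> p1" and \<alpha>: "\<forall>n. 0 < \<alpha> n"
  shows "banach_space_on (X_space e \<alpha> p0 p1) (X_norm e \<alpha> p0 p1)"
  unfolding X_space_eq X_norm_eq[abs_def]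
proof (rule banach_space_on_graph_norm)
  interpret e: bounded_linear e by fact
  let ?\<beta> = "\<lambda>n. \<alpha> n powr (1 - p1)"
  have \<beta>: "\<forall>n. 0 < ?\<beta> n"
    using \<alpha> by (simp add: less_imp_neq[symmetric])
  show 0: "banach_space_on (weighted_lp_space \<alpha> p0 :: (nat \<Rightarrow> 'b0) set) (weighted_lp_norm \<alpha> p0)"
    by (rule banach_space_on_weighted_lp[OF \<alpha> p(1)])
  show 1: "banach_space_on (weighted_lp_space ?\<beta> p1 :: (nat \<Rightarrow> 'b1) set) (weighted_lp_norm ?\<beta> p1)"
    by (rule banach_space_on_weighted_lp[OF \<beta> p(2)])
  show "linear (\<lambda>x n. e (x (Suc n) - x n))"
    by (rule linear_increments) (rule e.linear)
  have sub: "subspace (weighted_lp_space \<alpha> p0 :: (nat \<Rightarrow> 'b0) set)"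
    "subspace (weighted_lp_space ?\<beta> p1 :: (nat \<Rightarrow> 'b1) set)"
    using 0 1 by (auto simp: banach_space_on_def normed_space_on_def)
  fix x :: "nat \<Rightarrow> nat \<Rightarrow> 'b0" and l m
  assume mem: "\<And>k. x k \<in> weighted_lp_space \<alpha> p0"
      "\<And>k. (\<lambda>n. e (x k (Suc n) - x k n)) \<in> weighted_lp_space ?\<beta> p1"
      "l \<in> weighted_lp_space \<alpha> p0" "m \<in> weighted_lp_space ?\<beta> p1"
    and l: "(\<lambda>k. weighted_lp_norm \<alpha> p0 (x k - l)) \<longlonglongrightarrow> 0"
    and m: "(\<lambda>k. weighted_lp_norm ?\<beta> p1 ((\<lambda>n. e (x k (Suc n) - x k n)) - m)) \<longlonglongrightarrow> 0"
  have xl: "(\<lambda>k. x k n) \<longlonglongrightarrow> l n" for n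
    using weighted_lp_tendsto_coordinate[OF \<alpha> p(1) _ l] subspace_diff[OF sub(1)] mem by blast
  have "(\<lambda>k. e (x k (Suc n) - x k n)) \<longlonglongrightarrow> m n" for n
    using weighted_lp_tendsto_coordinate[OF \<beta> p(2) _ m] subspace_diff[OF sub(2)] mem by blast
  moreover have "(\<lambda>k. e (x k (Suc n) - x k n)) \<longlonglongrightarrow> e (l (Suc n) - l n)" for n
    by (intro e.tendsto tendsto_diff xl)
  ultimately show "(\<lambda>n. e (l (Suc n) - l n)) = m"
    by (intro ext) (rule LIMSEQ_unique)
qed

text \<open>
  The weight \<open>\<alpha>\<^sup>1\<^sup>-\<^sup>p\<close> on the increments is the one for which \<open>d \<le> \<alpha> + \<alpha>\<^sup>1\<^sup>-\<^sup>p d\<^sup>p\<close>: either \<open>d \<le> \<alpha>\<close>, or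
  \<open>d / \<alpha> \<le> (d / \<alpha>)\<^sup>p\<close>. Hence the total variation of \<open>n \<mapsto> e (x n)\<close> is at most \<open>\<Sum>\<alpha>\<close> plus the
  \<open>p\<close>-th power of the increment norm, and the initial value is controlled by the other part of
  the norm.
\<close>

lemma X_space_uniformly_bounded:
  fixes e :: "'b0::real_normed_vector \<Rightarrow> 'b1::real_normed_vector"
  assumes e: "bounded_linear e" and p: "1 \<le> p0" "1 \<le> p1"
    and \<alpha>: "\<forall>n. 0 < \<alpha> n" "summable \<alpha>"
  obtains C where "\<And>x n. x \<in> X_space e \<alpha> p0 p1 \<Longrightarrow> X_norm e \<alpha> p0 p1 x \<le> c \<Longrightarrow> norm (e (x n)) \<le> C"
proof -
  interpret e: bounded_linear e by fact
  define \<beta> where "\<beta> n = \<alpha> n powr (1 - p1)" for n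
  obtain K where K: "0 \<le> K" "\<And>u. norm (e u) \<le> norm u * K"
    using e.nonneg_bounded by blast
  have \<beta>: "\<forall>n. 0 \<le> \<beta> n"
    by (simp add: \<beta>_def)
  have young: "d \<le> a + a powr (1 - p1) * d powr p1" if a: "0 < a" and d: "0 \<le> d" for a d :: real
  proof (cases "d \<le> a")
    case True
    then show ?thesis
      by (simp add: add_increasing2)
  next
    case False
    then have "(d / a) powr 1 \<le> (d / a) powr p1"
      using a p by (intro powr_mono) auto
    then have "d \<le> a * (d powr p1 / a powr p1)"
      using a d by (simp add: powr_divide field_simps)
    also have "\<dots> = a powr (1 - p1) * d powr p1"
      using a by (simp add: powr_diff)
    finally show ?thesis
      using a by linarith
  qed
  have "norm (e (x n)) \<le> \<alpha> 0 powr (- 1 / p0) * c * K + (suminf \<alpha> + c powr p1)"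
    if x: "x \<in> X_space e \<alpha> p0 p1" "X_norm e \<alpha> p0 p1 x \<le> c" for x n
  proof -
    let ?d = "\<lambda>n. e (x (Suc n) - x n)"
    have x': "x \<in> weighted_lp_space \<alpha> p0" "?d \<in> weighted_lp_space \<beta> p1"
      using x by (auto simp: X_space_eq \<beta>_def[abs_def])
    have c: "0 \<le> weighted_lp_norm \<beta> p1 ?d" "weighted_lp_norm \<alpha> p0 x \<le> c" "weighted_lp_norm \<beta> p1 ?d \<le> c"
      using x(2) by (auto simp: X_norm_eq \<beta>_def[abs_def] weighted_lp_norm_def
          intro: order_trans[rotated])
    have telescope: "e (x n) = e (x 0) + (\<Sum>k<n. ?d k)"
      unfolding e.diff using sum_lessThan_telescope[of "\<lambda>n. e (x n)" n] by simp
    have "norm (e (x n)) \<le> norm (e (x 0)) + (\<Sum>k<n. norm (?d k))"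
      unfolding telescope by (rule order_trans[OF norm_triangle_ineq add_left_mono[OF norm_sum]])
    also have "(\<Sum>k<n. norm (?d k)) \<le> (\<Sum>k<n. \<alpha> k + \<beta> k * norm (?d k) powr p1)"
      unfolding \<beta>_def by (intro sum_mono young \<alpha>(1)[rule_format]) simp
    also have "\<dots> = (\<Sum>k<n. \<alpha> k) + (\<Sum>k<n. \<beta> k * norm (?d k) powr p1)"
      by (rule sum.distrib)
    also have "\<dots> \<le> suminf \<alpha> + weighted_lp_norm \<beta> p1 ?d powr p1"
      using \<alpha>
      by (intro add_mono sum_le_suminf sum_le_weighted_lp_norm_powr[OF \<beta> p(2) x'(2)])
        (auto simp: less_imp_le)
    also have "weighted_lp_norm \<beta> p1 ?d powr p1 \<le> c powr p1"
      using c p by (intro powr_mono2) auto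
    also have "norm (e (x 0)) \<le> norm (x 0) * K"
      by (rule K(2))
    also have "norm (x 0) \<le> \<alpha> 0 powr (- 1 / p0) * weighted_lp_norm \<alpha> p0 x"
      by (rule weighted_lp_norm_coordinate[OF \<alpha>(1) p(1) x'(1)])
    also have "weighted_lp_norm \<alpha> p0 x \<le> c"
      by (rule c(2))
    finally show ?thesis
      using K(1) by (simp add: mult_right_mono mult_left_mono)
  qed
  then show ?thesis
    using that by blast
qed

lemma weighted_lp_pointwise_bounded_linear:
  assumes f: "bounded_linear f" and w: "\<forall>n. 0 < w n" and p: "1 \<le> p" and x: "x \<in> weighted_lp_space w p"
  shows "(\<lambda>n. f (x n)) \<in> weighted_lp_space w p"
proof -
  interpret f: bounded_linear f by fact
  obtain K where K: "0 \<le> K" "\<And>u. norm (f u) \<le> norm u * K"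
    using f.nonneg_bounded by blast
  have "K *\<^sub>R x \<in> weighted_lp_space w p"
    using normed_space_on_weighted_lp[OF w p] x unfolding normed_space_on_def by (blast intro: subspace_mul)
  moreover have "norm (f (x n)) \<le> norm ((K *\<^sub>R x) n)" for n
    using K by (simp add: scaleR_fun_def mult.commute)
  ultimately show ?thesis
    using weighted_lp_norm_mono(1)[of w p "K *\<^sub>R x" "\<lambda>n. f (x n)"] w p by (simp add: less_imp_le)
qed

text \<open>
  The scalar sequence \<open>\<eta> \<parallel>z\<^sub>n\<parallel> + C \<parallel>e z\<^sub>n\<parallel>\<close> dominates \<open>\<parallel>i z\<^sub>n\<parallel>\<close>, so Minkowski's inequality over the
  reals carries the pointwise estimate to the sequence norms.
\<close>

lemma weighted_lp_Ehrling:
  assumes le: "\<And>u. norm (i u) \<le> \<eta> * norm u + C * norm (e u)" and \<eta>C: "0 \<le> \<eta>" "0 \<le> C"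
    and w: "\<forall>n. 0 < w n" and p: "1 \<le> p"
    and z: "z \<in> weighted_lp_space w p" "(\<lambda>n. e (z n)) \<in> weighted_lp_space w p"
  shows "weighted_lp_norm w p (\<lambda>n. i (z n))
    \<le> \<eta> * weighted_lp_norm w p z + C * weighted_lp_norm w p (\<lambda>n. e (z n))"
proof -
  define a where "a n = norm (z n)" for n
  define b where "b n = norm (e (z n))" for n
  have w': "\<forall>n. 0 \<le> w n"
    using w by (simp add: less_imp_le)
  have ab: "a \<in> weighted_lp_space w p" "b \<in> weighted_lp_space w p"
    using z by (simp_all add: a_def b_def weighted_lp_space_def)
  note R = normed_space_on_weighted_lp[where 'b = real, OF w p, unfolded normed_space_on_def]
  have sc: "\<eta> *\<^sub>R a \<in> weighted_lp_space w p" "C *\<^sub>R b \<in> weighted_lp_space w p"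
    using R ab by (simp_all add: subspace_mul)
  have "weighted_lp_norm w p (\<lambda>n. i (z n)) \<le> weighted_lp_norm w p (\<eta> *\<^sub>R a + C *\<^sub>R b)"
  proof (rule weighted_lp_norm_mono(2)[OF w' p])
    show "\<eta> *\<^sub>R a + C *\<^sub>R b \<in> weighted_lp_space w p"
      by (rule weighted_lp_triangle(1)[OF w p sc])
    show "norm (i (z n)) \<le> norm ((\<eta> *\<^sub>R a + C *\<^sub>R b) n)" for n
      using le[of "z n"] by (simp add: scaleR_fun_def a_def b_def)
  qed
  also have "\<dots> \<le> weighted_lp_norm w p (\<eta> *\<^sub>R a) + weighted_lp_norm w p (C *\<^sub>R b)"
    by (rule weighted_lp_triangle(2)[OF w p sc])
  also have "\<dots> = \<eta> * weighted_lp_norm w p a + C * weighted_lp_norm w p b"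
    using R ab \<eta>C by simp
  finally show ?thesis
    by (simp add: weighted_lp_norm_def a_def b_def)
qed

theorem corollary5p9:
  fixes i :: "'b0::banach \<Rightarrow> 'b::banach"
    and j :: "'b \<Rightarrow> 'b1::banach"
    and \<alpha> :: "nat \<Rightarrow> real"
    and p0 p1 :: real
  assumes "reflexive TYPE('b0)" and "reflexive TYPE('b1)"
    and "compact_embedding i" and "continuous_embedding j"
    and "1 < p0" and "1 < p1"
    and "\<And>n. 0 < \<alpha> n" and "summable \<alpha>"
  shows "banach_space_on (X_space (j \<circ> i) \<alpha> p0 p1) (X_norm (j \<circ> i) \<alpha> p0 p1)
    \<and> compact_linear_map_on
        (X_space (j \<circ> i) \<alpha> p0 p1) (X_norm (j \<circ> i) \<alpha> p0 p1)
        (weighted_lp_space \<alpha> p0) (weighted_lp_norm \<alpha> p0)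
        (\<lambda>x n. i (x n))"
proof
  note i = \<open>compact_embedding i\<close> and j = \<open>continuous_embedding j\<close> 
  have p: "1 \<le> p0" "1 \<le> p1"
    using assms by simp_all
  have \<alpha>: "\<forall>n. 0 < \<alpha> n" and \<alpha>': "\<forall>n. 0 \<le> \<alpha> n"
    using \<open>\<And>n. 0 < \<alpha> n\<close> by (simp_all add: less_imp_le)
  have il: "bounded_linear i" and jl: "bounded_linear j"
    using i j by (auto simp: compact_embedding_def continuous_embedding_def)
  interpret i: bounded_linear i by (rule il)
  interpret j: bounded_linear j by (rule jl)
  define e where "e = j \<circ> i"
  have e: "bounded_linear e"
    unfolding e_def using bounded_linear_compose[OF jl il] by (simp add: o_def)
  interpret e: bounded_linear e by (rule e)
  let ?S = "X_space e \<alpha> p0 p1" and ?N = "X_norm e \<alpha> p0 p1"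
  have banach: "banach_space_on ?S ?N"
    by (rule banach_space_on_X_space[OF e p \<alpha>])
  then show "banach_space_on (X_space (j \<circ> i) \<alpha> p0 p1) (X_norm (j \<circ> i) \<alpha> p0 p1)"
    by (simp add: e_def)
  have normed: "normed_space_on ?S ?N"
    using banach by (simp add: banach_space_on_def)
  have "compact_linear_map_on ?S ?N (weighted_lp_space \<alpha> p0) (weighted_lp_norm \<alpha> p0) (\<lambda>x n. i (x n))"
  proof (rule compact_linear_map_onI[OF normed])
    show "banach_space_on (weighted_lp_space \<alpha> p0 :: (nat \<Rightarrow> 'b) set) (weighted_lp_norm \<alpha> p0)"
      by (rule banach_space_on_weighted_lp[OF \<alpha> p(1)])
    show "linear (\<lambda>(x :: nat \<Rightarrow> 'b0) n. i (x n))"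
      by (rule linear_pointwise) (rule i.linear)
    show "(\<lambda>x n. i (x n)) ` ?S \<subseteq> weighted_lp_space \<alpha> p0"
      using weighted_lp_pointwise_bounded_linear[OF il \<alpha> p(1)] by (auto simp: X_space_eq)
    fix x :: "nat \<Rightarrow> nat \<Rightarrow> 'b0" and c
    assume x: "\<And>k. x k \<in> ?S" "\<And>k. ?N (x k) \<le> c"
    have x0: "x k \<in> weighted_lp_space \<alpha> p0" "weighted_lp_norm \<alpha> p0 (x k) \<le> c" for k
      using x[of k] by (auto simp: X_space_eq X_norm_eq weighted_lp_norm_def intro: order_trans[rotated])
    have c: "0 \<le> c"
      using x0(2)[of 0] by (rule order_trans[rotated]) (simp add: weighted_lp_norm_def)
    have bound: "norm (x k n) \<le> \<alpha> n powr (- 1 / p0) * c" for k n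
      using weighted_lp_norm_coordinate[OF \<alpha> p(1) x0(1), of k n]
        mult_left_mono[OF x0(2)[of k], of "\<alpha> n powr (- 1 / p0)"] by simp
    obtain r y where r: "strict_mono (r :: nat \<Rightarrow> nat)"
      and y: "\<And>n. (\<lambda>k. i (x (r k) n)) \<longlonglongrightarrow> y n"
      by (rule compact_embedding_diagonal_subseq[OF i, of x "\<lambda>n. \<alpha> n powr (- 1 / p0) * c", OF bound]) (rule that)
    \<comment> \<open>Over \<open>B\<^sub>1\<close> the limit sequence is at hand, and \<open>u k\<close> is the error.\<close>
    define v where "v n = j (y n)" for n
    have v: "(\<lambda>k. e (x (r k) n)) \<longlonglongrightarrow> v n" for n
      unfolding e_def v_def o_def by (rule j.tendsto[OF y])
    obtain C where "norm (e (z n)) \<le> C" if "z \<in> ?S" "?N z \<le> c" for z n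
      by (rule X_space_uniformly_bounded[OF e p \<alpha> \<open>summable \<alpha>\<close>, of c]) (rule that)
    then have C: "norm (e (x k n)) \<le> C" for k n
      using x by simp
    have vC: "norm (v n) \<le> C" for n
      using tendsto_norm[OF v[of n]] by (rule tendsto_upperbound) (auto simp: C)
    define u where "u k n = e (x (r k) n) - v n" for k n
    have uC: "norm (u k n) \<le> C + C" for k n
      unfolding u_def using C vC by (intro norm_triangle_le_diff add_mono)
    have u: "u k \<in> weighted_lp_space \<alpha> p0" for k
      by (rule weighted_lp_bounded[OF \<alpha>' \<open>summable \<alpha>\<close> p(1) uC])
    have lim: "(\<lambda>k. weighted_lp_norm \<alpha> p0 (u k)) \<longlonglongrightarrow> 0"
      using v by (intro weighted_lp_dominated_convergence[OF \<alpha>' \<open>summable \<alpha>\<close> p(1) uC])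
        (simp add: u_def LIM_zero)
    note diff_mem = weighted_lp_diff(1)[OF \<alpha> p(1)] and diff = weighted_lp_diff(2)[OF \<alpha> p(1)]
    have "\<exists>M. \<forall>k\<ge>M. \<forall>m\<ge>M.
        weighted_lp_norm \<alpha> p0 ((\<lambda>n. i (x (r k) n)) - (\<lambda>n. i (x (r m) n))) < \<epsilon>"
      if \<epsilon>: "0 < \<epsilon>" for \<epsilon> :: real
    proof -
      \<comment> \<open>Differences are bounded by \<open>2 c\<close> over \<open>B\<^sub>0\<close>; this part may use up half of \<open>\<epsilon>\<close>.
        The summand \<open>1\<close> covers the case \<open>c = 0\<close>.\<close>
      define \<eta> where "\<eta> = \<epsilon> / (4 * (c + 1))"
      have \<eta>: "0 < \<eta>" "\<eta> * (c + c) < \<epsilon> / 2"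
        using \<epsilon> c by (simp_all add: \<eta>_def field_simps)
      obtain K where K: "0 \<le> K" "\<And>u. norm (i u) \<le> \<eta> * norm u + K * norm (e u)"
        using Ehrling[OF i j \<eta>(1)] unfolding e_def o_def by blast
      have "(\<lambda>k. K * weighted_lp_norm \<alpha> p0 (u k)) \<longlonglongrightarrow> 0"
        using tendsto_mult_left[OF lim] by simp
      then obtain M where M: "\<And>k. M \<le> k \<Longrightarrow> K * weighted_lp_norm \<alpha> p0 (u k) < \<epsilon> / 4"
        using order_tendstoD(2)[of _ 0 sequentially "\<epsilon> / 4"] \<epsilon> by (auto simp: eventually_sequentially)
      have "weighted_lp_norm \<alpha> p0 ((\<lambda>n. i (x (r k) n)) - (\<lambda>n. i (x (r m) n))) < \<epsilon>"
        if km: "M \<le> k" "M \<le> m" for k m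
      proof -
        let ?z = "x (r k) - x (r m)"
        have ez: "(\<lambda>n. e (?z n)) = u k - u m"
          by (auto simp: fun_eq_iff u_def e.diff)
        have "(\<lambda>n. i (x (r k) n)) - (\<lambda>n. i (x (r m) n)) = (\<lambda>n. i (?z n))"
          by (auto simp: fun_eq_iff i.diff)
        then have "weighted_lp_norm \<alpha> p0 ((\<lambda>n. i (x (r k) n)) - (\<lambda>n. i (x (r m) n)))
            \<le> \<eta> * weighted_lp_norm \<alpha> p0 ?z + K * weighted_lp_norm \<alpha> p0 (u k - u m)"
          using weighted_lp_Ehrling[OF K(2) less_imp_le[OF \<eta>(1)] K(1) \<alpha> p(1), of ?z]
            diff_mem[OF x0(1) x0(1), of "r k" "r m"] diff_mem[OF u u, of k m] ez by simp
        also have "\<dots> \<le> \<eta> * (c + c) + K * (weighted_lp_norm \<alpha> p0 (u k) + weighted_lp_norm \<alpha> p0 (u m))"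
          using order_trans[OF diff[OF x0(1) x0(1)] add_mono[OF x0(2) x0(2)]] diff[OF u u] \<eta>(1) K(1)
          by (intro add_mono mult_left_mono) auto
        also have "\<dots> < \<epsilon>"
          using \<eta>(2) M[OF km(1)] M[OF km(2)] by (simp add: distrib_left)
        finally show ?thesis .
      qed
      then show ?thesis
        by blast
    qed
    then show "\<exists>r. strict_mono (r :: nat \<Rightarrow> nat) \<and> (\<forall>\<epsilon>>0. \<exists>M. \<forall>k\<ge>M. \<forall>m\<ge>M.
        weighted_lp_norm \<alpha> p0 ((\<lambda>n. i (x (r k) n)) - (\<lambda>n. i (x (r m) n))) < \<epsilon>)"
      using r by (intro exI[of _ r]) simp
  qed
  then show "compact_linear_map_on
      (X_space (j \<circ> i) \<alpha> p0 p1) (X_norm (j \<circ> i) \<alpha> p0 p1)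
      (weighted_lp_space \<alpha> p0) (weighted_lp_norm \<alpha> p0) (\<lambda>x n. i (x n))"
    by (simp add: e_def)
qed

end
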